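(* For every integer $m\ge 0$, $$\sum_{n=0}^{\infty}\frac{1}{(2n+1)^{2m+2}}=(-1)^{m+1}\frac{E_{2m+1}}{4\,(2m+1)!}\,\pi^{2m+2}.$$
   Context: The Euler numbers $E_n$, $n\ge 0$, are defined by $$\frac{2}{e^t+1}=\sum_{n=0}^{\infty}E_n\frac{t^n}{n!}\qquad(|t|<\pi),$$ so that $E_0=1$, $E_1=-\tfrac12$, $E_2=0$, $E_3=\tfrac14$, and so on. *)

theory Defs
  imports "HOL-Complex_Analysis.Complex_Analysis"
begin

(* These are the coefficients of 2 / (exp t + 1), i.e. the values at 0 of the Euler polynomials,
   not the (integer) secant numbers that also go by the name of Euler numbers.
   The definite description is justified by egf_2_over_exp_plus_1_unique below. *)
definition euler_number :: "nat \<Rightarrow> real" where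
  "euler_number =
     (THE E. \<forall>t::real. \<bar>t\<bar> < pi \<longrightarrow> (\<lambda>n. E n * t ^ n / fact n) sums (2 / (exp t + 1)))"

lemma egf_2_over_exp_plus_1_exists:
  "\<exists>E. \<forall>t::real. \<bar>t\<bar> < pi \<longrightarrow> (\<lambda>n. E n * t ^ n / fact n) sums (2 / (exp t + 1))"
proof -
  define f :: "complex \<Rightarrow> complex" where "f = (\<lambda>z. 2 / (exp z + 1))"
  have nz: "exp z + 1 \<noteq> 0" if "z \<in> ball 0 pi" for z :: complex
  proof
    assume "exp z + 1 = 0"
    then have "exp z = exp (\<i> * pi)"
      by (simp add: add_eq_0_iff2)
    then obtain k :: int where k: "z = \<i> * pi + (of_int (2 * k) * pi) * \<i>"
      unfolding exp_eq by blast
    have Im_z: "Im z = pi * of_int (1 + 2 * k)"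
      using k by (simp add: algebra_simps)
    have "1 + 2 * k \<noteq> 0"
      by presburger
    then have "1 \<le> \<bar>real_of_int (1 + 2 * k)\<bar>"
      by linarith
    then have "pi \<le> \<bar>Im z\<bar>"
      unfolding Im_z abs_mult by simp
    moreover have "\<bar>Im z\<bar> < pi"
      using that abs_Im_le_cmod[of z] by simp
    ultimately show False
      by simp
  qed
  have hol: "f holomorphic_on ball 0 pi"
    unfolding f_def using nz by (intro holomorphic_intros) auto
  have "(\<lambda>n. Re ((deriv ^^ n) f 0) * t ^ n / fact n) sums (2 / (exp t + 1))"
    if "\<bar>t\<bar> < pi" for t :: real
  proof -
    have "(\<lambda>n. (deriv ^^ n) f 0 / fact n * (of_real t - 0) ^ n) sums f (of_real t)"
      using that by (intro holomorphic_power_series[OF hol]) simp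
    then have "(\<lambda>n. Re ((deriv ^^ n) f 0 / fact n * (of_real t - 0) ^ n)) sums Re (f (of_real t))"
      by (rule sums_Re)
    moreover have "Re ((deriv ^^ n) f 0 / fact n * (of_real t - 0) ^ n) =
        Re ((deriv ^^ n) f 0) * t ^ n / fact n" for n
    proof -
      have "(deriv ^^ n) f 0 / fact n * (of_real t - 0) ^ n =
          (deriv ^^ n) f 0 * of_real (t ^ n / fact n)"
        by simp
      also have "Re \<dots> = Re ((deriv ^^ n) f 0) * (t ^ n / fact n)"
        by (simp only: times_complex.sel Re_complex_of_real Im_complex_of_real mult_zero_right diff_zero)
      finally show ?thesis
        by simp
    qed
    moreover have "f (of_real t) = of_real (2 / (exp t + 1))"
      by (simp add: f_def exp_of_real)
    ultimately show ?thesis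
      by simp
  qed
  then show ?thesis
    by (intro exI[of _ "\<lambda>n. Re ((deriv ^^ n) f 0)"] allI impI)
qed

lemma egf_2_over_exp_plus_1_unique:
  "\<exists>!E. \<forall>t::real. \<bar>t\<bar> < pi \<longrightarrow> (\<lambda>n. E n * t ^ n / fact n) sums (2 / (exp t + 1))"
proof (rule ex_ex1I[OF egf_2_over_exp_plus_1_exists])
  fix E F :: "nat \<Rightarrow> real"
  assume E: "\<forall>t::real. \<bar>t\<bar> < pi \<longrightarrow> (\<lambda>n. E n * t ^ n / fact n) sums (2 / (exp t + 1))"
    and F: "\<forall>t::real. \<bar>t\<bar> < pi \<longrightarrow> (\<lambda>n. F n * t ^ n / fact n) sums (2 / (exp t + 1))"
  define a where "a = (\<lambda>n. (E n - F n) / fact n)"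
  have a_sums: "(\<lambda>n. a n * t ^ n) sums 0" if "\<bar>t\<bar> < pi" for t
    using sums_diff[OF E[rule_format, OF that] F[rule_format, OF that]]
    by (simp add: a_def left_diff_distrib diff_divide_distrib)
  have "a n = 0" for n
  proof (induction n rule: less_induct)
    case (less n)
    have "(\<lambda>k. a (k + n) * t ^ k) sums 0" if "t \<noteq> 0" "\<bar>t\<bar> < pi" for t
    proof -
      have "(\<lambda>k. a (k + n) * t ^ (k + n)) sums 0"
        using a_sums[OF that(2)] less by (subst sums_iff_shift) simp
      then have "(\<lambda>k. a (k + n) * t ^ (k + n) / t ^ n) sums (0 / t ^ n)"
        by (rule sums_divide)
      then show ?thesis
        using that by (simp add: power_add)
    qed
    then have "((\<lambda>t::real. 0::real) \<longlongrightarrow> a (0 + n)) (at 0)"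
      by (intro powser_limit_0_strong[of pi "\<lambda>k. a (k + n)"]) auto
    then show "a n = 0"
      by (metis LIM_const_eq add_0)
  qed
  then show "E = F"
    by (auto simp: a_def)
qed

lemma euler_number_sums:
  fixes t :: real
  assumes "\<bar>t\<bar> < pi"
  shows "(\<lambda>n. euler_number n * t ^ n / fact n) sums (2 / (exp t + 1))"
  using theI'[OF egf_2_over_exp_plus_1_unique, folded euler_number_def, rule_format, OF assms] .

end

theory Submission
  imports Defs
begin

text \<open>
  Both sides are Taylor data of one function. Up to the substitution \<open>z = \<i> t / (2 * pi)\<close>, the
  generating function \<open>2 / (exp t + 1)\<close> is \<open>1 + \<i> * tan (pi * z)\<close>, so the Euler numbers of odd
  index are, up to elementary factors, the Taylor coefficients of the tangent at \<open>0\<close>. On the other hand, logarithmic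
  differentiation of Euler's reflection formula gives
  \<open>pi * tan (pi * z) = Digamma (1 / 2 + z) - Digamma (1 / 2 - z)\<close>, and the derivatives of
  \<^const>\<open>Digamma\<close> are the polygamma functions, whose values at \<open>1 / 2\<close> are, up to sign
  and a factorial, the sums of the inverse powers of \<open>k + 1 / 2\<close>, that is, up to a power of \<open>2\<close>,
  of the odd numbers \<open>2 * k + 1\<close>.
  Comparing coefficients in \<open>t\<close>, which is legitimate by the uniqueness of the exponential
  generating function, expresses every Euler number of odd index by such a sum
  (\<open>euler_number_odd_eq_Polygamma\<close>). Passing through \<^const>\<open>Polygamma\<close> means that the double series
  obtained by expanding the partial fractions of the tangent never has to be rearranged.
\<close>

text \<open>
  The reciprocal Gamma function is entire, so the reflection formula can be differentiated in the
  form \<open>rGamma (1 / 2 + z) * rGamma (1 / 2 - z) = cos (pi * z) / pi\<close> without regard to poles. The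
  hypothesis says exactly that neither factor vanishes, i.e. that both Digamma values are regular.
\<close>

lemma Digamma_reflection_half:
  fixes z :: complex
  assumes "cos (of_real pi * z) \<noteq> 0"
  shows "Digamma (1 / 2 + z) - Digamma (1 / 2 - z) = of_real pi * tan (of_real pi * z)"
proof -
  have reflection: "rGamma (1 / 2 + w) * rGamma (1 / 2 - w) = cos (of_real pi * w) / of_real pi"
    for w :: complex
  proof -
    have "rGamma (1 / 2 + w) * rGamma (1 / 2 - w) = sin (of_real pi * (1 / 2 + w)) / of_real pi"
      using rGamma_reflection_complex[of "1 / 2 + w"] by simp
    also have "sin (of_real pi * (1 / 2 + w)) = cos (of_real pi * w)"
      by (simp add: distrib_left sin_add flip: of_real_divide sin_of_real cos_of_real)
    finally show ?thesis .
  qed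
  have "rGamma (1 / 2 + z) * rGamma (1 / 2 - z) \<noteq> 0"
    using assms by (simp add: reflection)
  then have regular: "1 / 2 + z \<notin> \<int>\<^sub>\<le>\<^sub>0" "1 / 2 - z \<notin> \<int>\<^sub>\<le>\<^sub>0"
    by (auto simp: rGamma_eq_zero_iff)
  have "((\<lambda>w. rGamma (1 / 2 + w) * rGamma (1 / 2 - w)) has_field_derivative
          - (rGamma (1 / 2 + z) * rGamma (1 / 2 - z)) *
            (Digamma (1 / 2 + z) - Digamma (1 / 2 - z))) (at z)"
    using regular by (auto intro!: derivative_eq_intros simp: algebra_simps)
  moreover have "((\<lambda>w. cos (of_real pi * w) / of_real pi) has_field_derivative
          - sin (of_real pi * z)) (at z)"
    by (auto intro!: derivative_eq_intros)
  ultimately have "- (cos (of_real pi * z) / of_real pi) *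
      (Digamma (1 / 2 + z) - Digamma (1 / 2 - z)) = - sin (of_real pi * z)"
    unfolding reflection by (rule DERIV_unique)
  then show ?thesis
    using assms by (simp add: tan_def field_simps)
qed

lemma Digamma_power_series_half:
  fixes z :: complex
  assumes "norm z < 1 / 2"
  shows "(\<lambda>n. of_real (Polygamma n (1 / 2)) / fact n * z ^ n) sums Digamma (1 / 2 + z)"
proof -
  have "0 < Re w" if "w \<in> ball (1 / 2 :: complex) (1 / 2)" for w
    using that abs_Re_le_cmod[of "1 / 2 - w"] by (simp add: dist_norm)
  then have "ball (1 / 2 :: complex) (1 / 2) \<inter> \<int>\<^sub>\<le>\<^sub>0 = {}"
    by (force elim!: nonpos_Ints_cases)
  then have "Digamma holomorphic_on ball (1 / 2 :: complex) (1 / 2)"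
    by (rule holomorphic_on_Polygamma)
  then have "(\<lambda>n. (deriv ^^ n) Digamma (1 / 2) / fact n * (1 / 2 + z - 1 / 2) ^ n)
      sums Digamma (1 / 2 + z)"
    using assms by (intro holomorphic_power_series) (auto simp: dist_norm)
  moreover have "(deriv ^^ n) Digamma (1 / 2 :: complex) = of_real (Polygamma n (1 / 2))" for n
  proof -
    have "(1 / 2 :: complex) \<notin> \<int>\<^sub>\<le>\<^sub>0"
      using fraction_not_in_Ints[of 2 1, where 'a = complex] nonpos_Ints_subset_Ints by auto
    then show ?thesis
      using Polygamma_of_real[of "1 / 2" n, where 'a = complex] by (simp add: higher_deriv_Polygamma)
  qed
  ultimately show ?thesis
    by simp
qed

lemma one_plus_i_tan:
  fixes w :: complex
  assumes "cos w \<noteq> 0"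
  shows "1 + \<i> * tan w = 2 / (exp (- 2 * \<i> * w) + 1)"
proof -
  have "exp (\<i> * w) * (exp (- 2 * \<i> * w) + 1) = 2 * cos w"
    by (simp add: cos_exp_eq distrib_left flip: exp_add)
  moreover from this have "exp (- 2 * \<i> * w) + 1 \<noteq> 0"
    using assms by (metis mult_eq_0_iff zero_neq_numeral)
  ultimately have "exp (\<i> * w) / cos w = 2 / (exp (- 2 * \<i> * w) + 1)"
    using assms frac_eq_eq by blast
  moreover have "exp (\<i> * w) / cos w = 1 + \<i> * tan w"
    using assms by (simp add: exp_Euler tan_def add_divide_distrib)
  ultimately show ?thesis
    by simp
qed

text \<open>
  Expand \<open>2 / (exp t + 1) = 1 + \<i> / pi * (Digamma (1 / 2 + z) - Digamma (1 / 2 - z))\<close> in powers of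
  \<open>z = \<i> t / (2 * pi)\<close>: in the difference
  the even powers of \<open>z\<close> cancel and the odd ones double. The condition
  \<open>\<bar>t\<bar> < pi\<close> places \<open>z\<close> inside the disc of convergence, whose radius \<open>1 / 2\<close> is the distance from
  \<open>1 / 2\<close> to the pole of \<^const>\<open>Digamma\<close> at \<open>0\<close>.
\<close>

lemma euler_number_odd_eq_Polygamma:
  "euler_number (2 * m + 1) =
     (-1) ^ (m + 1) * 2 * Polygamma (2 * m + 1) (1 / 2) / (pi * (2 * pi) ^ (2 * m + 1))"
proof -
  \<comment> \<open>For odd \<open>n\<close> the sign \<open>(-1) ^ (n div 2 + 1)\<close> is \<open>\<i> ^ (n + 1)\<close>: one factor \<open>\<i>\<close> comes from
    \<open>\<i> / pi\<close>, the other \<open>n\<close> from \<open>z ^ n\<close>.\<close>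
  define c :: "nat \<Rightarrow> real" where
    "c n = (if odd n then (-1) ^ (n div 2 + 1) * 2 * Polygamma n (1 / 2) / (pi * (2 * pi) ^ n) else 0)"
    for n
  define E where "E n = c n + (if n = 0 then 1 else 0)" for n
  have "(\<lambda>n. E n * t ^ n / fact n) sums (2 / (exp t + 1))" if t: "\<bar>t\<bar> < pi" for t :: real
  proof -
    define z :: complex where "z = \<i> * of_real (t / (2 * pi))"
    have norm_z: "norm z < 1 / 2"
      using t by (simp add: z_def norm_mult field_simps del: of_real_divide of_real_mult)
    have pi_z: "of_real pi * z = \<i> * of_real (t / 2)"
      by (simp add: z_def)
    have "cos (of_real pi * z) = of_real (cosh (t / 2))"
      unfolding pi_z cosh_conv_cos[symmetric] cosh_field_def
      by (simp flip: exp_of_real)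
    then have cos_nz: "cos (of_real pi * z) \<noteq> 0"
      by simp
    let ?p = "\<lambda>n. complex_of_real (Polygamma n (1 / 2)) / fact n"
    have "(\<lambda>n. ?p n * z ^ n - ?p n * (- z) ^ n) sums (Digamma (1 / 2 + z) - Digamma (1 / 2 - z))"
      using sums_diff[OF Digamma_power_series_half[of z] Digamma_power_series_half[of "- z"]] norm_z
      by simp
    then have "(\<lambda>n. \<i> / of_real pi * (?p n * z ^ n - ?p n * (- z) ^ n)) sums
        (\<i> / of_real pi * (of_real pi * tan (of_real pi * z)))"
      unfolding Digamma_reflection_half[OF cos_nz] by (rule sums_mult)
    then have "(\<lambda>n. \<i> / of_real pi * (?p n * z ^ n - ?p n * (- z) ^ n)) sums
        (\<i> * tan (of_real pi * z))"
      by simp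
    moreover have "\<i> / of_real pi * (?p n * z ^ n - ?p n * (- z) ^ n) =
        of_real (c n * t ^ n / fact n)" for n
    proof (cases "odd n")
      case True
      then obtain k where n: "n = 2 * k + 1"
        by (elim oddE)
      have "\<i> * z ^ n = (-1) ^ (k + 1) * of_real (t ^ n / (2 * pi) ^ n)"
      proof -
        have "\<i> * z ^ n = \<i> ^ (n + 1) * of_real (t ^ n / (2 * pi) ^ n)"
          by (simp add: z_def power_mult_distrib power_divide)
        also have "\<i> ^ (n + 1) = (\<i>\<^sup>2) ^ (k + 1)"
          by (simp add: n flip: power_mult)
        finally show ?thesis
          by simp
      qed
      moreover have "\<i> / of_real pi * (?p n * z ^ n - ?p n * (- z) ^ n) =
          2 * ?p n / of_real pi * (\<i> * z ^ n)"
        using True by (simp add: power_minus_odd mult_ac)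
      moreover have "c n = (-1) ^ (k + 1) * 2 * Polygamma n (1 / 2) / (pi * (2 * pi) ^ n)"
        by (simp add: c_def n)
      ultimately show ?thesis
        by (simp add: mult_ac)
    next
      case False
      then show ?thesis
        by (simp add: c_def)
    qed
    ultimately have "(\<lambda>n. of_real (c n * t ^ n / fact n)) sums (\<i> * tan (of_real pi * z))"
      by simp
    then have "(\<lambda>n. of_real (c n * t ^ n / fact n) + (if n = 0 then 1 else 0)) sums
        (\<i> * tan (of_real pi * z) + 1)"
      by (intro sums_add sums_single)
    moreover have "of_real (c n * t ^ n / fact n) + (if n = 0 then 1 else 0) =
        complex_of_real (E n * t ^ n / fact n)" for n
      by (simp add: E_def)
    moreover have "\<i> * tan (of_real pi * z) + 1 = of_real (2 / (exp t + 1))"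
    proof -
      have "- 2 * \<i> * (of_real pi * z) = of_real t"
        unfolding pi_z by simp
      then show ?thesis
        using one_plus_i_tan[OF cos_nz] by (simp add: add.commute exp_of_real)
    qed
    ultimately have "(\<lambda>n. complex_of_real (E n * t ^ n / fact n)) sums of_real (2 / (exp t + 1))"
      by simp
    then show ?thesis
      by (simp only: sums_of_real_iff)
  qed
  then have "euler_number = E"
    unfolding euler_number_def by (intro the1_equality[OF egf_2_over_exp_plus_1_unique]) blast
  then have "euler_number (2 * m + 1) = E (2 * m + 1)"
    by (rule fun_cong)
  then show ?thesis
    by (simp add: E_def c_def)
qed

theorem corollary5:
  fixes m :: nat
  shows "(\<lambda>n. 1 / (2 * real n + 1) ^ (2 * m + 2)) sums
           ((-1) ^ (m + 1) * (euler_number (2 * m + 1) / (4 * fact (2 * m + 1))) * pi ^ (2 * m + 2))"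
proof -
  let ?P = "Polygamma (2 * m + 1) (1 / 2 :: real)"
  have "(\<lambda>k. inverse ((1 / 2 + real k) ^ (2 * m + 2))) sums (?P / fact (2 * m + 1))"
    using Polygamma_LIMSEQ[of "1 / 2 :: real" "2 * m + 1"] by simp
  then have "(\<lambda>k. inverse ((1 / 2 + real k) ^ (2 * m + 2)) / 2 ^ (2 * m + 2)) sums
      (?P / fact (2 * m + 1) / 2 ^ (2 * m + 2))"
    by (rule sums_divide)
  moreover have "inverse ((1 / 2 + real k) ^ (2 * m + 2)) / 2 ^ (2 * m + 2) =
      1 / (2 * real k + 1) ^ (2 * m + 2)" for k
  proof -
    have "2 * real k + 1 = 2 * (1 / 2 + real k)"
      by simp
    then show ?thesis
      by (simp only: power_mult_distrib) (simp add: field_simps)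
  qed
  moreover have "?P / fact (2 * m + 1) / 2 ^ (2 * m + 2) =
      (-1) ^ (m + 1) * (euler_number (2 * m + 1) / (4 * fact (2 * m + 1))) * pi ^ (2 * m + 2)"
  proof -
    have "((-1) ^ (m + 1) * (-1) ^ (m + 1) :: real) = 1"
      by (simp flip: power_mult_distrib)
    moreover have "pi * (2 * pi) ^ (2 * m + 1) * 2 = pi ^ (2 * m + 2) * 2 ^ (2 * m + 2)"
      by (simp add: power_mult_distrib)
    ultimately show ?thesis
      unfolding euler_number_odd_eq_Polygamma
      by (simp add: power_mult_distrib divide_simps del: fact_Suc)
  qed
  ultimately show ?thesis
    by simp
qed

end
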